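(* Let $g$ be a continuously differentiable probability density with full support $\mathbb{R}$. The statistic $$\hat\mu^{(n)}(x_1,\dots,x_n)=\log\Bigl[\Bigl(n^{-1}\sum_{i=1}^n\exp(-x_i)\Bigr)^{-1}\Bigr]$$ is the maximum likelihood estimator of the location parameter $\mu$ in the location family $\{g(x-\mu):\mu\in\mathbb{R}\}$ for all samples $(x_1,\dots,x_n)\in\mathbb{R}^n$ of all sample sizes $n\ge1$ if and only if $g$ is a power-Gumbel density, that is, there exist $c,d\in(0,\infty)$ such that $g(x)=c\exp(-dx-d\exp(-x))$ for all $x\in\mathbb{R}$.
   Context: A density has full support $\mathbb{R}$ if it is strictly positive on $\mathbb{R}$. That $\hat\mu^{(n)}$ is the MLE of the location parameter for the family generated by $g$ at the sample $(x_1,\dots,x_n)$ means $$\prod_{i=1}^n g(x_i-\hat\mu^{(n)})\ \ge\ \prod_{i=1}^n g(x_i-\mu)\quad\text{for all }\mu\in\mathbb{R}.$$ *)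

theory Defs
  imports "HOL-Analysis.Analysis"
begin

definition probability_density :: "(real \<Rightarrow> real) \<Rightarrow> bool" where
  "probability_density g \<longleftrightarrow> (\<forall>x. 0 \<le> g x) \<and> has_bochner_integral lborel g 1"

definition full_support :: "(real \<Rightarrow> real) \<Rightarrow> bool" where
  "full_support g \<longleftrightarrow> (\<forall>x. 0 < g x)"

definition location_family :: "(real \<Rightarrow> real) \<Rightarrow> real \<Rightarrow> real \<Rightarrow> real" where
  "location_family g \<mu> = (\<lambda>x. g (x - \<mu>))"

text \<open>A sample of size \<open>n\<close> is a function \<open>x\<close> on the naturals of which only the values
  \<open>x 1, \<dots>, x n\<close> are used.\<close>

definition likelihood :: "(real \<Rightarrow> real \<Rightarrow> real) \<Rightarrow> nat \<Rightarrow> (nat \<Rightarrow> real) \<Rightarrow> real \<Rightarrow> real" where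
  "likelihood f n x \<mu> = (\<Prod>i = 1..n. f \<mu> (x i))"

text \<open>The maximizer is not required to be unique.\<close>

definition is_MLE :: "(real \<Rightarrow> real \<Rightarrow> real) \<Rightarrow> nat \<Rightarrow> (nat \<Rightarrow> real) \<Rightarrow> real \<Rightarrow> bool" where
  "is_MLE f n x m \<longleftrightarrow> (\<forall>\<mu>. likelihood f n x m \<ge> likelihood f n x \<mu>)"

definition mu_hat :: "nat \<Rightarrow> (nat \<Rightarrow> real) \<Rightarrow> real" where
  "mu_hat n x = ln (inverse (inverse (real n) * (\<Sum>i = 1..n. exp (- x i))))"

definition power_Gumbel_density :: "(real \<Rightarrow> real) \<Rightarrow> bool" where
  "power_Gumbel_density g \<longleftrightarrow>
     (\<exists>c>0. \<exists>d>0. \<forall>x. g x = c * exp (- d * x - d * exp (- x)))"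

end

theory Submission
  imports Defs
begin

text \<open>
  If \<open>\<mu>_hat\<close> is always an MLE, then the first-order condition says that the score
  \<open>\<psi> = g' / g\<close> satisfies \<open>\<Sum> \<psi> (y i) = 0\<close> whenever \<open>\<Sum> exp (- y i) = n\<close>. In the variable
  \<open>t = exp (- y)\<close>, the function \<open>\<phi> t = \<psi> (- ln t)\<close> therefore sums to zero over all positive
  tuples of mean one. Changing two coordinates while keeping their sum shows that
  \<open>\<phi> s + \<phi> t\<close> depends only on \<open>s + t\<close>; by continuity \<open>\<phi> t = d * (t - 1)\<close>, so
  \<open>(ln g)' y = d * (exp (- y) - 1)\<close>. The case \<open>d \<le> 0\<close> is excluded because \<open>g\<close> would then be
  bounded below by a positive constant. Conversely, the log-likelihood of a power-Gumbel density
  is, up to a constant, \<open>d * n * (\<mu> - exp (\<mu> - \<mu>_hat))\<close>, which is maximal at \<open>\<mu> = \<mu>_hat\<close>.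
\<close>

text \<open>Cauchy's functional equation on a half-line: additivity gives linearity at nonnegative
  rationals, and continuity carries it to the limit \<open>a\<close>.\<close>

lemma continuous_additive_on_nonneg_linear:
  fixes f :: "real \<Rightarrow> real"
  assumes cont: "continuous_on {0..} f"
    and add: "\<And>a b. 0 \<le> a \<Longrightarrow> 0 \<le> b \<Longrightarrow> f (a + b) = f a + f b"
    and a: "0 \<le> a"
  shows "f a = a * f 1"
proof -
  have mult: "f (real k * b) = real k * f b" if "0 \<le> b" for k b
  proof (induction k)
    case 0
    show ?case using add[of 0 0] by simp
  next
    case (Suc k)
    have "f (real (Suc k) * b) = f (real k * b + b)" by (simp add: algebra_simps)
    also have "\<dots> = f (real k * b) + f b" using that by (intro add) auto
    finally show ?case using Suc by (simp add: algebra_simps)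
  qed
  \<comment> \<open>\<open>r n\<close> is the largest multiple of \<open>1 / (n + 1)\<close> not
    exceeding \<open>a\<close>, so it stays in the domain and is within \<open>1 / (n + 1)\<close>
    of \<open>a\<close>.\<close>
  define r where "r = (\<lambda>n. real (nat \<lfloor>real (Suc n) * a\<rfloor>) / real (Suc n))"
  have fr: "f (r n) = r n * f 1" for n
    using mult[of "1 / real (Suc n)" "nat \<lfloor>real (Suc n) * a\<rfloor>"] mult[of "1 / real (Suc n)" "Suc n"]
    by (simp add: r_def field_simps)
  have bounds: "a - 1 / real (Suc n) \<le> r n" "r n \<le> a" for n
  proof -
    have "real (nat \<lfloor>real (Suc n) * a\<rfloor>) \<le> real (Suc n) * a"
      and "real (Suc n) * a - 1 \<le> real (nat \<lfloor>real (Suc n) * a\<rfloor>)"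
      using a by (auto intro!: of_nat_floor simp del: of_nat_Suc)
    from this[THEN divide_right_mono, of "real (Suc n)"]
    show "a - 1 / real (Suc n) \<le> r n" "r n \<le> a"
      by (simp_all add: r_def diff_divide_distrib del: of_nat_Suc)
  qed
  have "(\<lambda>n. a - 1 / real (Suc n)) \<longlonglongrightarrow> a - 0"
    by (intro tendsto_intros LIMSEQ_Suc[OF lim_1_over_n])
  then have lim: "r \<longlonglongrightarrow> a"
    using bounds by (intro tendsto_sandwich[of "\<lambda>n. a - 1 / real (Suc n)" r sequentially "\<lambda>_. a"]) auto
  have "(\<lambda>n. f (r n)) \<longlonglongrightarrow> f a"
    using a by (intro continuous_on_tendsto_compose[OF cont lim]) (auto simp: r_def)
  moreover have "(\<lambda>n. f (r n)) \<longlonglongrightarrow> a * f 1"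
    unfolding fr by (intro tendsto_intros lim)
  ultimately show ?thesis by (rule LIMSEQ_unique)
qed

lemma affine_if_sum_zero_on_mean_one:
  fixes \<phi> :: "real \<Rightarrow> real"
  assumes cont: "continuous_on {0<..} \<phi>"
    and zero: "\<And>n t. 1 \<le> n \<Longrightarrow> (\<And>i. 0 < t i) \<Longrightarrow> (\<Sum>i = 1..n. t i) = real n \<Longrightarrow>
      (\<Sum>i = 1..n. \<phi> (t i)) = 0"
  shows "\<exists>d. \<forall>t>0. \<phi> t = d * (t - 1)"
proof -
  have exchange: "\<phi> s + \<phi> t = \<phi> u + \<phi> v"
    if "0 < s" "0 < t" "0 < u" "0 < v" "s + t = u + v" for s t u v
  proof -
    obtain k :: nat where k: "s + t < real k" using reals_Archimedean2 by blast
    then have k0: "0 < k" using that by (cases k) auto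
    \<comment> \<open>\<open>k\<close> copies of \<open>w\<close> complete a pair with sum
      \<open>s + t\<close> to a tuple of length \<open>k + 2\<close> and mean one. As
      \<open>w\<close> sees the pair only through its sum, the same filler serves \<open>u\<close>,
      \<open>v\<close>.\<close>
    define w where "w = (real k + 2 - (s + t)) / real k"
    have w: "0 < w" using k k0 by (simp add: w_def)
    have *: "\<phi> a + \<phi> b + real k * \<phi> w = 0" if ab: "0 < a" "0 < b" "a + b = s + t" for a b
    proof -
      define y where "y = (\<lambda>i::nat. if i = 1 then a else if i = 2 then b else w)"
      have split: "(\<Sum>i = 1..k + 2. F (y i)) = F a + F b + real k * F w" for F :: "real \<Rightarrow> real"
      proof -
        have "{1..k + 2} = insert 1 (insert 2 {3..k + 2})" by auto
        then have "(\<Sum>i = 1..k + 2. F (y i)) = F (y 1) + (F (y 2) + (\<Sum>i = 3..k + 2. F (y i)))"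
          by simp
        also have "(\<Sum>i = 3..k + 2. F (y i)) = (\<Sum>i = 3..k + 2. F w)"
          by (intro sum.cong) (auto simp: y_def)
        finally show ?thesis by (simp add: y_def)
      qed
      have "(\<Sum>i = 1..k + 2. y i) = real (k + 2)"
        using split[of "\<lambda>x. x"] ab k0 by (simp add: w_def)
      then show ?thesis
        using zero[of "k + 2" y] split[of \<phi>] ab w by (simp add: y_def)
    qed
    show ?thesis using *[of s t] *[of u v] that by simp
  qed
  have one: "\<phi> 1 = 0" using zero[of 1 "\<lambda>_. 1"] by simp
  \<comment> \<open>Recentring at the zero 1 of \<open>\<phi>\<close> turns the exchange of
    \<open>1 + a\<close>, \<open>1 + b\<close> for \<open>1 + (a + b)\<close>, \<open>1\<close> into
    additivity.\<close>
  define f where "f = (\<lambda>a. \<phi> (1 + a))"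
  have "continuous_on {0..} f"
    unfolding f_def by (rule continuous_on_compose2[OF cont]) (auto intro!: continuous_intros)
  moreover have "f (a + b) = f a + f b" if "0 \<le> a" "0 \<le> b" for a b
    using exchange[of "1 + a" "1 + b" "1 + (a + b)" 1] that one by (simp add: f_def)
  ultimately have lin: "f a = a * f 1" if "0 \<le> a" for a
    using continuous_additive_on_nonneg_linear that by blast
  have "\<phi> t = f 1 * (t - 1)" if "0 < t" for t
  proof (cases "1 \<le> t")
    case True
    then show ?thesis using lin[of "t - 1"] by (simp add: f_def)
  next
    case False
    \<comment> \<open>Below 1, reflect: \<open>t\<close> and \<open>2 - t\<close> have the same sum
      as 1 and 1, and \<open>2 - t = 1 + (1 - t)\<close> lies where \<open>f\<close> is known to be
      linear.\<close>
    then have "\<phi> t = - f (1 - t)"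
      using exchange[of t "2 - t" 1 1] that one by (simp add: f_def)
    then show ?thesis using lin[of "1 - t"] False by (simp add: algebra_simps)
  qed
  then show ?thesis by blast
qed

lemma exp_neg_mu_hat:
  assumes "1 \<le> n"
  shows "exp (- mu_hat n x) = (\<Sum>i = 1..n. exp (- x i)) / real n"
proof -
  \<comment> \<open>A nonempty sample makes the argument of \<open>ln\<close> positive, so
    \<open>exp\<close> undoes it.\<close>
  have "0 < (\<Sum>i = 1..n. exp (- x i))" using assms by (intro sum_pos) auto
  then show ?thesis
    using assms by (simp add: mu_hat_def ln_inverse ln_mult field_simps exp_minus exp_diff)
qed

text \<open>By domination the constant \<open>b\<close> would be integrable, but the line has
  infinite measure.\<close>

lemma not_integrable_lborel_bounded_below:
  fixes g :: "real \<Rightarrow> real"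
  assumes "0 < b" "\<And>x. b \<le> g x"
  shows "\<not> integrable lborel g"
proof
  assume "integrable lborel g"
  then have "integrable lborel (\<lambda>_::real. b)"
    by (rule Bochner_Integration.integrable_bound)
      (use assms in \<open>auto intro!: AE_I2 intro: order_trans[OF _ abs_ge_self]\<close>)
  then show False using \<open>0 < b\<close> by (simp add: integrable_iff_bounded ennreal_mult_eq_top_iff)
qed

text \<open>First-order condition for the log-likelihood, a sum whose derivative at its global
  maximum 0 is minus the total score.\<close>

lemma score_sum_eq_0:
  assumes pos: "\<And>x. 0 < g x"
    and deriv: "\<And>x. (g has_real_derivative g' x) (at x)"
    and mle: "is_MLE (location_family g) n x 0"
  shows "(\<Sum>i = 1..n. g' (x i) / g (x i)) = 0"
proof -
  let ?l = "\<lambda>\<mu>. \<Sum>i = 1..n. ln (g (x i - \<mu>))"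
  have ln_likelihood: "ln (likelihood (location_family g) n x \<mu>) = ?l \<mu>" for \<mu>
    unfolding likelihood_def location_family_def by (rule ln_prod)
      (use pos in \<open>auto simp: less_imp_neq[symmetric]\<close>)
  have "0 < likelihood (location_family g) n x \<mu>" for \<mu>
    unfolding likelihood_def location_family_def by (rule prod_pos) (use pos in auto)
  then have max: "?l \<mu> \<le> ?l 0" for \<mu>
    using mle unfolding is_MLE_def ln_likelihood[symmetric] by simp
  have "((\<lambda>\<mu>. ln (g (x i - \<mu>))) has_real_derivative - (g' (x i) / g (x i))) (at 0)" for i
  proof -
    have "((\<lambda>\<mu>. g (x i - \<mu>)) has_real_derivative g' (x i - 0) * - 1) (at 0)"
      by (rule DERIV_chain2[OF deriv]) (auto intro!: derivative_eq_intros)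
    from DERIV_ln_divide[of "g (x i - 0)"] this have
      "((\<lambda>\<mu>. ln (g (x i - \<mu>))) has_real_derivative 1 / g (x i - 0) * (g' (x i - 0) * - 1)) (at 0)"
      using pos by (intro DERIV_chain2[where f = ln]) auto
    then show ?thesis by simp
  qed
  then have "(?l has_real_derivative (\<Sum>i = 1..n. - (g' (x i) / g (x i)))) (at 0)"
    by (intro DERIV_sum)
  then have "(\<Sum>i = 1..n. - (g' (x i) / g (x i))) = 0"
    by (rule DERIV_local_max[of _ _ _ 1]) (use max in auto)
  then show ?thesis by (simp add: sum_negf)
qed

lemma power_Gumbel_density_if_is_MLE_mu_hat:
  fixes g :: "real \<Rightarrow> real"
  assumes C1: "g C1_differentiable_on UNIV"
    and dens: "probability_density g"
    and supp: "full_support g"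
    and mle: "\<And>n x. 1 \<le> n \<Longrightarrow> is_MLE (location_family g) n x (mu_hat n x)"
  shows "power_Gumbel_density g"
proof -
  have pos: "0 < g x" for x using supp by (simp add: full_support_def)
  obtain g' where deriv: "\<And>x. (g has_real_derivative g' x) (at x)"
    and cont: "continuous_on UNIV g'"
    using C1 by (auto simp: C1_differentiable_on_def has_real_derivative_iff_has_vector_derivative)
  have contg: "continuous_on UNIV g"
    using deriv by (meson DERIV_isCont continuous_at_imp_continuous_on)
  define \<phi> where "\<phi> = (\<lambda>t. g' (- ln t) / g (- ln t))"
  have "\<exists>d. \<forall>t>0. \<phi> t = d * (t - 1)"
  proof (rule affine_if_sum_zero_on_mean_one)
    show "continuous_on {0<..} \<phi>"
      unfolding \<phi>_def using pos
      by (auto intro!: continuous_intros continuous_on_compose2[OF cont] continuous_on_compose2[OF contg]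
          simp: less_imp_neq[OF pos, symmetric])
  next
    fix n :: nat and t :: "nat \<Rightarrow> real"
    assume n: "1 \<le> n" and t: "\<And>i. 0 < t i" "(\<Sum>i = 1..n. t i) = real n"
    \<comment> \<open>Mean one of \<open>t\<close> says exactly that the estimate for the sample
      \<open>- ln (t i)\<close> is 0.\<close>
    have "exp (- mu_hat n (\<lambda>i. - ln (t i))) = 1"
      using n t by (simp add: exp_neg_mu_hat)
    then have "is_MLE (location_family g) n (\<lambda>i. - ln (t i)) 0"
      using mle[OF n, of "\<lambda>i. - ln (t i)"] by simp
    from score_sum_eq_0[of g, OF pos deriv this] show "(\<Sum>i = 1..n. \<phi> (t i)) = 0"
      by (simp add: \<phi>_def)
  qed
  then obtain d where "\<And>t. 0 < t \<Longrightarrow> \<phi> t = d * (t - 1)" by blast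
  from this[of "exp (- x)" for x] have score: "g' x / g x = d * (exp (- x) - 1)" for x
    by (simp add: \<phi>_def)
  \<comment> \<open>\<open>k\<close> is the log-ratio of \<open>g\<close> to the unnormalised
    power-Gumbel density; once it is constant, \<open>exp (k 0)\<close> is the sought
    \<open>c\<close>.\<close>
  define k where "k = (\<lambda>x. ln (g x) + d * x + d * exp (- x))"
  have "(k has_real_derivative 0) (at x)" for x
  proof -
    have "((\<lambda>x. ln (g x)) has_real_derivative 1 / g x * g' x) (at x)"
      by (rule DERIV_chain2[OF DERIV_ln_divide[OF pos] deriv])
    then have "((\<lambda>x. ln (g x)) has_real_derivative d * (exp (- x) - 1)) (at x)"
      using score[of x] by simp
    moreover have "((\<lambda>x. d * x + d * exp (- x)) has_real_derivative d - d * exp (- x)) (at x)"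
      by (auto intro!: derivative_eq_intros)
    ultimately have "((\<lambda>x. ln (g x) + (d * x + d * exp (- x))) has_real_derivative
        d * (exp (- x) - 1) + (d - d * exp (- x))) (at x)"
      by (rule DERIV_add)
    then show ?thesis by (simp add: k_def algebra_simps)
  qed
  then have k: "k x = k 0" for x by (intro DERIV_isconst_all) auto
  have g_eq: "g x = exp (k 0) * exp (- d * x - d * exp (- x))" for x
  proof -
    have "ln (g x) = k 0 + (- d * x - d * exp (- x))" using k[of x] by (simp add: k_def)
    then show ?thesis by (metis exp_add exp_ln pos)
  qed
  have "0 < d"
  proof (rule ccontr)
    assume "\<not> 0 < d"
    \<comment> \<open>The bound is the value at 0, where \<open>x + exp (- x)\<close> attains its
      minimum 1.\<close>
    have "exp (k 0) * exp (- d) \<le> g x" for x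
    proof -
      have "1 \<le> x + exp (- x)" using exp_ge_add_one_self[of "- x"] by simp
      then have "- d * 1 \<le> - d * (x + exp (- x))"
        using \<open>\<not> 0 < d\<close> by (intro mult_left_mono) auto
      then show ?thesis by (simp add: g_eq algebra_simps)
    qed
    then have "\<not> integrable lborel g"
      by (intro not_integrable_lborel_bounded_below[of "exp (k 0) * exp (- d)"]) auto
    then show False
      using dens by (auto simp: probability_density_def has_bochner_integral_iff)
  qed
  then show ?thesis
    unfolding power_Gumbel_density_def using g_eq by (metis exp_gt_zero)
qed

lemma is_MLE_mu_hat_if_power_Gumbel_density:
  assumes "power_Gumbel_density g" "1 \<le> n"
  shows "is_MLE (location_family g) n x (mu_hat n x)"
  unfolding is_MLE_def
proof
  fix \<mu>
  obtain c d where cd: "0 < c" "0 < d" and g: "\<And>x. g x = c * exp (- d * x - d * exp (- x))"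
    using assms by (auto simp: power_Gumbel_density_def)
  let ?m = "mu_hat n x"
  have S: "(\<Sum>i = 1..n. exp (- x i)) = real n * exp (- ?m)"
    using exp_neg_mu_hat[OF assms(2), of x] assms(2) by simp
  \<comment> \<open>The exponent involves the sample through its plain sum, free of
    \<open>\<nu>\<close>, and its exponential sum, which \<open>S\<close> rewrites in terms of
    \<open>?m\<close>.\<close>
  have lik: "likelihood (location_family g) n x \<nu> =
      c ^ n * exp (- d * (\<Sum>i = 1..n. x i) + d * (real n * (\<nu> - exp (\<nu> - ?m))))" for \<nu>
  proof -
    have "(\<Sum>i = 1..n. - d * (x i - \<nu>) - d * exp (- (x i - \<nu>))) =
        (\<Sum>i = 1..n. - d * x i + d * \<nu> - d * exp \<nu> * exp (- x i))"
      by (intro sum.cong) (auto simp: algebra_simps exp_diff exp_minus divide_inverse)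
    also have "\<dots> = - d * (\<Sum>i = 1..n. x i) + real n * (d * \<nu>) - d * exp \<nu> * (\<Sum>i = 1..n. exp (- x i))"
      by (simp only: sum_subtractf sum.distrib sum_distrib_left sum_constant card_atLeastAtMost) simp
    also have "\<dots> = - d * (\<Sum>i = 1..n. x i) + d * (real n * (\<nu> - exp (\<nu> - ?m)))"
      by (simp only: S) (simp add: algebra_simps exp_diff exp_minus divide_inverse)
    finally show ?thesis
      by (simp add: likelihood_def location_family_def g prod.distrib exp_sum[symmetric])
  qed
  \<comment> \<open>This is \<open>1 + u \<le> exp u\<close> at \<open>u = \<mu> - ?m\<close>;
    \<open>exp (?m - ?m)\<close> is left unevaluated to match \<open>lik\<close> at
    \<open>?m\<close>.\<close>
  have "\<mu> - exp (\<mu> - ?m) \<le> ?m - exp (?m - ?m)"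
    using exp_ge_add_one_self[of "\<mu> - ?m"] unfolding diff_self exp_zero by linarith
  then have "d * (real n * (\<mu> - exp (\<mu> - ?m))) \<le> d * (real n * (?m - exp (?m - ?m)))"
    using cd by (intro mult_left_mono) auto
  then show "likelihood (location_family g) n x \<mu> \<le> likelihood (location_family g) n x ?m"
    unfolding lik using cd by (intro mult_left_mono) auto
qed

theorem corollary7p3:
  fixes g :: "real \<Rightarrow> real"
  assumes "g C1_differentiable_on UNIV"
    and "probability_density g"
    and "full_support g"
  shows "(\<forall>n\<ge>1. \<forall>x :: nat \<Rightarrow> real. is_MLE (location_family g) n x (mu_hat n x))
           \<longleftrightarrow> power_Gumbel_density g"
  using power_Gumbel_density_if_is_MLE_mu_hat[OF assms] is_MLE_mu_hat_if_power_Gumbel_density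
  by blast

end
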